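(* Let $n\ge 2$ be an integer, and let $A\subset\mathbf{N}^n$ be the set of exponent vectors $$A=\{\log(x_{i_1}x_{i_2}\cdots x_{i_n}) \mid i_1\in\{1,2\},\ i_2\in\{2,3\},\ \ldots,\ i_{n-1}\in\{n-1,n\},\ i_n\in\{1,n\}\}.$$ Let $$N=\{\nu_{\{k+1\}},\ \nu_{\{\sigma^k(1),\sigma^k(2),\ldots,\sigma^k(i)\}} \mid 0\le k\le n-1,\ 2\le i\le n-1\}.$$ Then $$\mathbf{R}_+C_A=\bigcap_{a\in N}H_a^+,$$ and the facets of the cone $\mathbf{R}_+C_A$ are exactly the sets $H_a\cap\mathbf{R}_+C_A$ with $a\in N$.
   Context: For a monomial $x^u=x_1^{u_1}\cdots x_n^{u_n}$, $\log(x^u)=u=(u_1,\ldots,u_n)\in\mathbf{N}^n$, where $\mathbf{N}=\{0,1,2,\ldots\}$. $C_A=\sum_{\alpha\in A}\mathbf{N}\alpha$ is the subsemigroup of $\mathbf{N}^n$ generated by $A$, and $\mathbf{R}_+C_A=\mathbf{R}_+A$ is the cone of all finite combinations $\sum a_i\gamma_i$ with $a_i\in\mathbf{R}_+$ (nonnegative reals) and $\gamma_i\in A$. For $0\ne a\in\mathbf{R}^n$, $H_a=\{x\in\mathbf{R}^n\mid\langle x,a\rangle=0\}$ and $H_a^+=\{x\in\mathbf{R}^n\mid\langle x,a\rangle\ge0\}$, with the usual inner product. A proper face of a polyhedral cone $Q\subset \mathbf{R}^n$ is a subset $F=Q\cap H_a\neq\emptyset$ where $Q\subset H_a^+$ and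 $Q\not\subseteq H_a$; a facet is a proper face $F$ with $\dim F=\dim Q-1$. Normal vectors: for $1\le i\le n-1$, $\nu_{[i]}\in\mathbf{R}^n$ is the vector whose first $i$ coordinates are $-(n-i-1)$ and whose last $n-i$ coordinates are $i+1$. Let $\sigma\in S_n$ be the $n$-cycle $\sigma=\prod_{i=1}^{n-1}(i,i+1)$, so that $\sigma^k(s)\equiv k+s \pmod n$. For $0\le k\le n-1$, $\nu_{\{k+1\}}$ is obtained from $\nu_{[1]}$ by exchanging the first and $(k+1)$-st coordinates; that is, its coordinate $k+1$ is $-(n-2)$ and all other coordinates are $2$. For $0\le k\le n-1$ and $2\le i\le n-1$, $\nu_{\{\sigma^k(1),\ldots,\sigma^k(i)\}}$ is obtained from $\nu_{[i]}$ by cyclically shifting coordinates $k$ places to the right; that is, its coordinates in positions $\sigma^k(1),\ldots,\sigma^k(i)$ are $-(n-i-1)$ and all other coordinates are $i+1$. *)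

theory Defs
  imports "HOL-Analysis.Analysis" "HOL-Combinatorics.Transposition" "HOL-Library.Multiset"
begin

text \<open>
  Coordinates of \<open>\<real>\<^sup>n\<close> are indexed by a finite type \<open>'v\<close> with \<open>n\<close> elements, which also serves as
  the set of variables.  A numbering \<open>x\<close>, a bijection from \<open>{1..n}\<close> onto \<open>'v\<close>, names them
  \<open>x 1, \<dots>, x n\<close>, so that positions can be treated as natural numbers.
\<close>

text \<open>A monomial is the multiset of its variables; its logarithm is the vector of multiplicities.\<close>

definition log_monomial :: "'v multiset \<Rightarrow> nat ^ 'v" where
  "log_monomial m = (\<chi> v. count m v)"

definition A_set :: "nat \<Rightarrow> (nat \<Rightarrow> 'v) \<Rightarrow> (nat ^ 'v) set" where
  "A_set n x = {log_monomial {# x (i j). j \<in># mset_set {1..n} #} | i.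
      (\<forall>j\<in>{1..<n}. i j \<in> {j, j + 1}) \<and> i n \<in> {1, n}}"

definition gen_semigroup :: "(nat ^ 'v) set \<Rightarrow> (nat ^ 'v) set" where
  "gen_semigroup A = {\<Sum>\<alpha>\<in>T. m \<alpha> *s \<alpha> | T m. finite T \<and> T \<subseteq> A}"

definition real_vec :: "nat ^ 'v \<Rightarrow> real ^ 'v" where
  "real_vec u = (\<chi> v. real (u $ v))"

definition nonneg_cone :: "(real ^ 'v) set \<Rightarrow> (real ^ 'v) set" where
  "nonneg_cone S = {\<Sum>\<gamma>\<in>T. a \<gamma> *\<^sub>R \<gamma> | T a. finite T \<and> T \<subseteq> S \<and> (\<forall>\<gamma>\<in>T. 0 \<le> a \<gamma>)}"

definition R_cone :: "(nat ^ 'v) set \<Rightarrow> (real ^ 'v) set" where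
  "R_cone B = nonneg_cone (real_vec ` B)"

definition hyperplane :: "real ^ 'v \<Rightarrow> (real ^ 'v) set" where
  "hyperplane a = {y. y \<bullet> a = 0}"

definition halfspace :: "real ^ 'v \<Rightarrow> (real ^ 'v) set" where
  "halfspace a = {y. y \<bullet> a \<ge> 0}"

definition proper_face :: "(real ^ 'v) set \<Rightarrow> (real ^ 'v) set \<Rightarrow> bool" where
  "proper_face F Q \<longleftrightarrow>
     (\<exists>a. a \<noteq> 0 \<and> F = Q \<inter> hyperplane a \<and> F \<noteq> {} \<and> Q \<subseteq> halfspace a \<and> \<not> Q \<subseteq> hyperplane a)"

definition cone_facet :: "(real ^ 'v) set \<Rightarrow> (real ^ 'v) set \<Rightarrow> bool" where
  "cone_facet F Q \<longleftrightarrow> proper_face F Q \<and> aff_dim F = aff_dim Q - 1"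

text \<open>The product \<open>(1,2)(2,3)\<cdots>(n-1,n)\<close>, where the rightmost factor acts first.\<close>

definition cyc_sigma :: "nat \<Rightarrow> nat \<Rightarrow> nat" where
  "cyc_sigma n = foldr (\<lambda>i p. Transposition.transpose i (i + 1) \<circ> p) [1..<n] id"

text \<open>
  The vector \<open>\<nu>\<^sub>S\<close> for a set \<open>S\<close> of positions with \<open>i = card S\<close>; the vector \<open>\<nu>\<^bsub>[i]\<^esub>\<close> is the case
  \<open>S = {1..i}\<close>, and \<open>nu_shift\<close>, \<open>nu_exchange\<close> below relate the others to it.
\<close>

definition nu :: "nat \<Rightarrow> (nat \<Rightarrow> 'v) \<Rightarrow> nat set \<Rightarrow> real ^ 'v" where
  "nu n x S = (\<chi> v. if v \<in> x ` S then - (real n - real (card S) - 1) else real (card S) + 1)"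

definition N_set :: "nat \<Rightarrow> (nat \<Rightarrow> 'v) \<Rightarrow> (real ^ 'v) set" where
  "N_set n x = {nu n x {k + 1} | k. k \<le> n - 1}
     \<union> {nu n x ((cyc_sigma n ^^ k) ` {1..i}) | k i. k \<le> n - 1 \<and> 2 \<le> i \<and> i \<le> n - 1}"

lemma foldr_transpose:
  assumes "a \<le> n"
  shows "foldr (\<lambda>i p. Transposition.transpose i (i + 1) \<circ> p) [a..<n] id s =
    (if a \<le> s \<and> s < n then s + 1 else if s = n then a else s)"
  using assms
proof (induction a rule: inc_induct)
  case base
  then show ?case by simp
next
  case (step m)
  have "foldr (\<lambda>i p. Transposition.transpose i (i + 1) \<circ> p) [m..<n] id s =
      Transposition.transpose m (m + 1)
        (foldr (\<lambda>i p. Transposition.transpose i (i + 1) \<circ> p) [Suc m..<n] id s)"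
    using step.hyps by (simp add: upt_conv_Cons)
  also have "\<dots> = Transposition.transpose m (m + 1)
      (if Suc m \<le> s \<and> s < n then s + 1 else if s = n then Suc m else s)"
    by (simp only: step.IH)
  also have "\<dots> = (if m \<le> s \<and> s < n then s + 1 else if s = n then m else s)"
    using step.hyps by (auto simp: Transposition.transpose_def)
  finally show ?case .
qed

lemma cyc_sigma_eq: "1 \<le> n \<Longrightarrow> s \<in> {1..n} \<Longrightarrow> cyc_sigma n s = (if s < n then s + 1 else 1)"
  unfolding cyc_sigma_def by (subst foldr_transpose) auto

lemma cyc_sigma_funpow:
  assumes "s \<in> {1..n}"
  shows "(cyc_sigma n ^^ k) s \<in> {1..n} \<and> (cyc_sigma n ^^ k) s mod n = (k + s) mod n"
proof (induction k)
  case 0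
  then show ?case using assms by auto
next
  case (Suc k)
  let ?t = "(cyc_sigma n ^^ k) s"
  have t: "?t \<in> {1..n}" "?t mod n = (k + s) mod n" and n: "1 \<le> n"
    using Suc assms by auto
  have "cyc_sigma n ?t mod n = Suc ?t mod n"
    using cyc_sigma_eq[OF n t(1)] t(1) by (cases "?t < n") (auto simp: mod_Suc)
  also have "\<dots> = Suc (k + s) mod n"
    using t(2) by (metis mod_Suc_eq)
  finally have "cyc_sigma n ?t mod n = (Suc k + s) mod n" by simp
  moreover have "cyc_sigma n ?t \<in> {1..n}"
    using cyc_sigma_eq[OF n t(1)] n by simp
  ultimately show ?case by simp
qed

lemma inj_on_cyc_sigma_funpow: "inj_on (cyc_sigma n ^^ k) {1..n}"
proof (induction k)
  case 0
  then show ?case by simp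
next
  case (Suc k)
  have "inj_on (cyc_sigma n) {1..n}"
  proof (rule inj_onI)
    fix s t assume st: "s \<in> {1..n}" "t \<in> {1..n}" "cyc_sigma n s = cyc_sigma n t"
    then have "(if s < n then s + 1 else 1) = (if t < n then t + 1 else 1)"
      using cyc_sigma_eq[of n s] cyc_sigma_eq[of n t] by simp
    with st(1,2) show "s = t" by (cases "s < n"; cases "t < n") auto
  qed
  moreover have "(cyc_sigma n ^^ k) ` {1..n} \<subseteq> {1..n}"
    using cyc_sigma_funpow by (meson image_subsetI)
  ultimately have "inj_on (cyc_sigma n) ((cyc_sigma n ^^ k) ` {1..n})"
    by (rule inj_on_subset)
  with Suc show ?case by (simp only: funpow.simps) (rule comp_inj_on)
qed

lemma nu_shift:
  assumes "bij_betw x {1..n} UNIV" "i \<le> n" "s \<in> {1..n}"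
  shows "nu n x ((cyc_sigma n ^^ k) ` {1..i}) $ x ((cyc_sigma n ^^ k) s) = nu n x {1..i} $ x s"
proof -
  let ?f = "cyc_sigma n ^^ k"
  have sub: "{1..i} \<subseteq> {1..n}" using assms by auto
  have inj: "inj_on ?f {1..i}" using inj_on_subset[OF inj_on_cyc_sigma_funpow sub] .
  have fs: "?f ` {1..n} \<subseteq> {1..n}" using cyc_sigma_funpow by blast
  have ix: "inj_on x {1..n}" using assms(1) by (rule bij_betw_imp_inj_on)
  have "x (?f s) \<in> x ` ?f ` {1..i} \<longleftrightarrow> ?f s \<in> ?f ` {1..i}"
    using inj_on_image_mem_iff[OF ix] fs sub assms(3) by (meson image_mono imageI subset_iff subset_trans)
  also have "\<dots> \<longleftrightarrow> s \<in> {1..i}"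
    using inj_on_image_mem_iff[OF inj_on_cyc_sigma_funpow assms(3) sub] .
  also have "\<dots> \<longleftrightarrow> x s \<in> x ` {1..i}"
    using inj_on_image_mem_iff[OF ix assms(3) sub] by simp
  finally show ?thesis
    using card_image[OF inj] by (simp add: nu_def)
qed

lemma nu_exchange:
  assumes "bij_betw x {1..n} UNIV" "k < n" "s \<in> {1..n}"
  shows "nu n x {k + 1} $ x s = nu n x {1..1} $ x (Transposition.transpose 1 (k + 1) s)"
proof -
  have "x s = x (k + 1) \<longleftrightarrow> s = k + 1"
    using assms by (intro inj_on_eq_iff[of x "{1..n}"]) (auto simp: bij_betw_def)
  moreover have "x (Transposition.transpose 1 (k + 1) s) = x 1 \<longleftrightarrow> Transposition.transpose 1 (k + 1) s = 1"
    using assms by (intro inj_on_eq_iff[of x "{1..n}"]) (auto simp: bij_betw_def Transposition.transpose_def)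
  ultimately show ?thesis
    by (auto simp: nu_def Transposition.transpose_def split: if_splits)
qed

lemma nonneg_cone_superset: "S \<subseteq> nonneg_cone S"
proof
  fix y assume "y \<in> S"
  then show "y \<in> nonneg_cone S"
    unfolding nonneg_cone_def by (intro CollectI exI[of _ "{y}"] exI[of _ "\<lambda>_. 1"]) auto
qed

lemma nonneg_cone_add:
  assumes "y \<in> nonneg_cone S" "z \<in> nonneg_cone S"
  shows "y + z \<in> nonneg_cone S"
proof -
  obtain T a where T: "y = (\<Sum>\<gamma>\<in>T. a \<gamma> *\<^sub>R \<gamma>)" "finite T" "T \<subseteq> S" "\<forall>\<gamma>\<in>T. 0 \<le> a \<gamma>"
    using assms(1) unfolding nonneg_cone_def by blast
  obtain U b where U: "z = (\<Sum>\<gamma>\<in>U. b \<gamma> *\<^sub>R \<gamma>)" "finite U" "U \<subseteq> S" "\<forall>\<gamma>\<in>U. 0 \<le> b \<gamma>"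
    using assms(2) unfolding nonneg_cone_def by blast
  let ?a = "\<lambda>\<gamma>. if \<gamma> \<in> T then a \<gamma> else 0" and ?b = "\<lambda>\<gamma>. if \<gamma> \<in> U then b \<gamma> else 0"
  have "y = (\<Sum>\<gamma>\<in>T \<union> U. ?a \<gamma> *\<^sub>R \<gamma>)"
    unfolding T(1) using T(2) U(2) by (intro sum.mono_neutral_cong_left) auto
  moreover have "z = (\<Sum>\<gamma>\<in>T \<union> U. ?b \<gamma> *\<^sub>R \<gamma>)"
    unfolding U(1) using T(2) U(2) by (intro sum.mono_neutral_cong_left) auto
  ultimately have "y + z = (\<Sum>\<gamma>\<in>T \<union> U. (?a \<gamma> + ?b \<gamma>) *\<^sub>R \<gamma>)"
    by (simp only: scaleR_left_distrib sum.distrib)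
  then show ?thesis unfolding nonneg_cone_def
    using T U by (intro CollectI exI[of _ "T \<union> U"] exI[of _ "\<lambda>\<gamma>. ?a \<gamma> + ?b \<gamma>"]) auto
qed

lemma nonneg_cone_scaleR:
  assumes "y \<in> nonneg_cone S" "0 \<le> c"
  shows "c *\<^sub>R y \<in> nonneg_cone S"
proof -
  obtain T a where T: "y = (\<Sum>\<gamma>\<in>T. a \<gamma> *\<^sub>R \<gamma>)" "finite T" "T \<subseteq> S" "\<forall>\<gamma>\<in>T. 0 \<le> a \<gamma>"
    using assms(1) unfolding nonneg_cone_def by blast
  then show ?thesis unfolding nonneg_cone_def using assms(2)
    by (intro CollectI exI[of _ T] exI[of _ "\<lambda>\<gamma>. c * a \<gamma>"]) (auto simp: scaleR_sum_right)
qed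

lemma nonneg_cone_zero: "0 \<in> nonneg_cone S"
  unfolding nonneg_cone_def by (intro CollectI exI[of _ "{}"]) auto

lemma nonneg_cone_sum:
  assumes "finite T" "\<And>t. t \<in> T \<Longrightarrow> f t \<in> nonneg_cone S"
  shows "sum f T \<in> nonneg_cone S"
  using assms by (induction T rule: finite_induct) (auto simp: nonneg_cone_zero nonneg_cone_add)

lemma nonneg_cone_subset:
  assumes "S \<subseteq> nonneg_cone S'"
  shows "nonneg_cone S \<subseteq> nonneg_cone S'"
proof
  fix y assume "y \<in> nonneg_cone S"
  then obtain T a where T: "y = (\<Sum>\<gamma>\<in>T. a \<gamma> *\<^sub>R \<gamma>)" "finite T" "T \<subseteq> S" "\<forall>\<gamma>\<in>T. 0 \<le> a \<gamma>"
    unfolding nonneg_cone_def by blast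
  then show "y \<in> nonneg_cone S'"
    using assms by (auto intro!: nonneg_cone_sum nonneg_cone_scaleR)
qed

lemma real_vec_sum: "real_vec (\<Sum>\<alpha>\<in>T. m \<alpha> *s \<alpha>) = (\<Sum>\<alpha>\<in>T. real (m \<alpha>) *\<^sub>R real_vec \<alpha>)"
  by (simp add: real_vec_def vec_eq_iff)

lemma R_cone_gen_semigroup: "R_cone (gen_semigroup A) = R_cone A"
proof
  have "real_vec ` gen_semigroup A \<subseteq> nonneg_cone (real_vec ` A)"
  proof safe
    fix u assume "u \<in> gen_semigroup A"
    then obtain T m where "u = (\<Sum>\<alpha>\<in>T. m \<alpha> *s \<alpha>)" "finite T" "T \<subseteq> A"
      unfolding gen_semigroup_def by blast
    then show "real_vec u \<in> nonneg_cone (real_vec ` A)"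
      using nonneg_cone_superset[of "real_vec ` A"]
      by (auto simp: real_vec_sum intro!: nonneg_cone_sum nonneg_cone_scaleR)
  qed
  then show "R_cone (gen_semigroup A) \<subseteq> R_cone A"
    unfolding R_cone_def by (rule nonneg_cone_subset)
next
  have "A \<subseteq> gen_semigroup A"
  proof
    fix u assume "u \<in> A"
    then show "u \<in> gen_semigroup A" unfolding gen_semigroup_def
      by (intro CollectI exI[of _ "{u}"] exI[of _ "\<lambda>_. 1"]) (auto simp: vec_eq_iff)
  qed
  then have "real_vec ` A \<subseteq> nonneg_cone (real_vec ` gen_semigroup A)"
    using nonneg_cone_superset by blast
  then show "R_cone A \<subseteq> R_cone (gen_semigroup A)"
    unfolding R_cone_def by (rule nonneg_cone_subset)
qed

end

theory Submission
  imports Defs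
begin

text \<open>
  Think of the positions \<open>1, \<dots>, n\<close> as the vertices of an \<open>n\<close>-cycle whose edge \<open>j\<close> joins \<open>j\<close> to its
  successor.  A vector of \<open>A\<close> arises by letting every edge give one unit of mass to one of its two ends.
  Splitting the units gives a real version: if every edge has mass \<open>c\<close> and edge \<open>j\<close> gives the part
  \<open>t j \<in> {0..c}\<close> to \<open>j\<close> and the rest to the successor of \<open>j\<close>, the vertices receive a vector
  \<open>edge_vec n x c t\<close>.  Splitting one edge at a time writes this vector as a nonnegative combination of
  elements of \<open>A\<close> (\<open>edge_vec_in_cone\<close>), so all vectors of this kind lie in the cone.

  The sets of positions in the definition of \<open>N\<close> are the proper arcs of the cycle.  Such an arc is
  determined by the edge \<open>i\<close> that enters it and the edge \<open>j \<noteq> i\<close> that leaves it, and a count of masses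
  gives the formula that carries the proof (\<open>edge_vec_inner_nu_arc\<close>):
  the vector \<open>edge_vec n x c t\<close> has inner product \<open>n * (c - t j + t i)\<close> with the normal of this arc.
  It is nonnegative if \<open>t\<close> takes values in \<open>{0..c}\<close>.  Conversely, any vector \<open>y\<close> is \<open>edge_vec n x c t\<close>
  with \<open>c\<close> the mean of the coordinates and \<open>t\<close> their centred partial sums, which may be
  changed by a constant; the inequalities for all \<open>i \<noteq> j\<close> say that the values of \<open>t\<close> differ by at
  most \<open>c\<close>, so that a constant moves all of them into \<open>{0..c}\<close> (\<open>dual_cone_imp_edge_vec\<close>).

  For the facets, take \<open>c = 2\<close>, \<open>t j = 2\<close>, \<open>t i = 0\<close> and \<open>t = 1\<close> elsewhere.  The formula
  vanishes for the pair \<open>(i, j)\<close> and is positive for all other pairs, so none of the inequalities is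
  redundant.  The facets of a full-dimensional cone given by finitely many irredundant inequalities
  are its intersections with the bounding hyperplanes (\<open>facets_of_irredundant_cone\<close>).
\<close>

section \<open>Facets of a cone given by irredundant inequalities\<close>

lemma strict_positivity_open:
  fixes z h :: "real ^ 'v::finite"
  assumes "finite M" "\<And>b. b \<in> M \<Longrightarrow> z \<bullet> b > 0"
  shows "\<exists>e>0. \<forall>b\<in>M. (z + e *\<^sub>R h) \<bullet> b > 0"
proof -
  have "\<forall>\<^sub>F e in at_right 0. \<forall>b\<in>M. (z + e *\<^sub>R h) \<bullet> b > 0"
  proof (intro eventually_ball_finite assms(1) ballI)
    fix b assume "b \<in> M"
    have "((\<lambda>e. (z + e *\<^sub>R h) \<bullet> b) \<longlongrightarrow> (z + 0 *\<^sub>R h) \<bullet> b) (at_right 0)"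
      by (intro tendsto_intros)
    then show "\<forall>\<^sub>F e in at_right 0. (z + e *\<^sub>R h) \<bullet> b > 0"
      using assms(2)[OF \<open>b \<in> M\<close>] by (intro order_tendstoD(1)) auto
  qed
  then have "\<forall>\<^sub>F e::real in at_right 0. e > 0 \<and> (\<forall>b\<in>M. (z + e *\<^sub>R h) \<bullet> b > 0)"
    using eventually_at_right_less by (intro eventually_conj) auto
  then show ?thesis using eventually_happens trivial_limit_at_right_real by fastforce
qed

lemma in_span_if_translate:
  fixes z h :: "real ^ 'v::finite"
  assumes "z \<in> S" "z + e *\<^sub>R h \<in> S" "e \<noteq> 0"
  shows "h \<in> span S"
proof -
  have "(1 / e) *\<^sub>R ((z + e *\<^sub>R h) - z) \<in> span S"
    using assms by (intro span_scale span_diff span_base)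
  then show ?thesis using assms(3) by simp
qed

lemma aff_dim_zero_dim:
  fixes S :: "(real ^ 'v::finite) set"
  assumes "0 \<in> S"
  shows "aff_dim S = int (dim S)"
  using assms by (simp add: aff_dim_zero hull_inc)

lemma dim_hyperplane_origin:
  fixes a :: "real ^ 'v::finite"
  assumes "a \<noteq> 0"
  shows "dim (hyperplane a) = CARD('v) - 1"
  using dim_hyperplane[OF assms] by (simp add: hyperplane_def inner_commute)

lemma subspace_hyperplane_origin:
  fixes a :: "real ^ 'v::finite"
  shows "subspace (hyperplane a)"
  unfolding hyperplane_def by (auto simp: subspace_def inner_add_left)

text \<open>
  The point \<open>w\<close> makes the cone full-dimensional, and the points \<open>z\<close> make every wall span its hyperplane.
  A facet \<open>F\<close> cut out by \<open>a\<close> lies in some wall: otherwise a sum of points of \<open>F\<close>, one off each wall,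
  would be a point of \<open>F\<close> satisfying all inequalities strictly, and moving it slightly
  along \<open>-a\<close> would stay inside the cone and leave the half-space of \<open>a\<close>.  Once \<open>F\<close> lies in a wall, comparing
  dimensions shows that \<open>a\<close> and the normal of the wall define the same hyperplane.
\<close>

lemma facets_of_irredundant_cone:
  fixes N :: "(real ^ 'v::finite) set" and w :: "real ^ 'v"
  defines "C \<equiv> \<Inter>b\<in>N. halfspace b"
  assumes fin: "finite N"
    and w: "\<And>b. b \<in> N \<Longrightarrow> w \<bullet> b > 0"
    and irred: "\<And>b. b \<in> N \<Longrightarrow> \<exists>z. z \<bullet> b = 0 \<and> (\<forall>b'\<in>N - {b}. z \<bullet> b' > 0)"
  shows "{F. cone_facet F C} = {hyperplane b \<inter> C | b. b \<in> N}"
proof -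
  have C: "y \<in> C \<longleftrightarrow> (\<forall>b\<in>N. y \<bullet> b \<ge> 0)" for y by (simp add: C_def halfspace_def)
  have C0: "0 \<in> C" by (simp add: C)
  have wC: "w \<in> C" using w by (auto simp: C intro: less_imp_le)
  have "span C = UNIV"
  proof -
    have "h \<in> span C" for h
    proof -
      obtain e where e: "e > 0" "\<forall>b\<in>N. (w + e *\<^sub>R h) \<bullet> b > 0"
        using strict_positivity_open[OF fin w] by blast
      then have "w + e *\<^sub>R h \<in> C" by (auto simp: C intro: less_imp_le)
      with wC e(1) show ?thesis by (intro in_span_if_translate) auto
    qed
    then show ?thesis by auto
  qed
  then have dimC: "aff_dim C = int CARD('v)"
    using aff_dim_zero_dim[OF C0] by (metis dim_UNIV DIM_cart DIM_real dim_span mult.right_neutral)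
  show ?thesis
  proof (intro equalityI subsetI)
    fix F assume "F \<in> {hyperplane b \<inter> C | b. b \<in> N}"
    then obtain b where b: "b \<in> N" and F: "F = hyperplane b \<inter> C" by auto
    have b0: "b \<noteq> 0" using w[OF b] by auto
    obtain z where z: "z \<bullet> b = 0" "\<And>b'. b' \<in> N - {b} \<Longrightarrow> z \<bullet> b' > 0" using irred[OF b] by auto
    have zF: "z \<in> F" using z by (force simp: F C hyperplane_def)
    have "hyperplane b \<subseteq> span F"
    proof
      fix h assume h: "h \<in> hyperplane b"
      have "finite (N - {b})" using fin by simp
      then obtain e where e: "e > 0" "\<forall>b'\<in>N - {b}. (z + e *\<^sub>R h) \<bullet> b' > 0"
        using strict_positivity_open[of "N - {b}" z h] z(2) by blast
      have hb: "(z + e *\<^sub>R h) \<bullet> b = 0" using h z by (simp add: hyperplane_def inner_add_left)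
      have "(z + e *\<^sub>R h) \<bullet> b' \<ge> 0" if "b' \<in> N" for b'
        using that e(2) hb by (cases "b' = b") (auto intro: less_imp_le)
      then have "z + e *\<^sub>R h \<in> F" using hb by (auto simp: F C hyperplane_def)
      with zF e(1) show "h \<in> span F" by (intro in_span_if_translate) auto
    qed
    moreover have "span F \<subseteq> hyperplane b"
      using F by (intro span_minimal subspace_hyperplane_origin) auto
    ultimately have "dim F = CARD('v) - 1"
      using dim_hyperplane_origin[OF b0] by (metis dim_span subset_antisym)
    moreover have F0: "0 \<in> F" using C0 by (simp add: F hyperplane_def)
    ultimately have "aff_dim F = aff_dim C - 1"
      by (simp add: aff_dim_zero_dim dimC of_nat_diff)
    moreover have "proper_face F C"
      unfolding proper_face_def
    proof (intro exI[of _ b] conjI)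
      show "C \<subseteq> halfspace b" using b by (auto simp: C_def)
      show "\<not> C \<subseteq> hyperplane b" using wC w[OF b] by (auto simp: hyperplane_def)
    qed (use b0 F F0 in auto)
    ultimately show "F \<in> {F. cone_facet F C}" by (simp add: cone_facet_def)
  next
    fix F assume "F \<in> {F. cone_facet F C}"
    then obtain a where a: "a \<noteq> 0" "F = C \<inter> hyperplane a" "C \<subseteq> halfspace a"
      and dimF: "aff_dim F = aff_dim C - 1"
      by (auto simp: cone_facet_def proper_face_def)
    have "\<exists>b\<in>N. F \<subseteq> hyperplane b"
    proof (rule ccontr)
      assume "\<not> ?thesis"
      then have "\<forall>b\<in>N. \<exists>y. y \<in> F \<and> y \<bullet> b \<noteq> 0" by (auto simp: hyperplane_def)
      then obtain f where f: "\<And>b. b \<in> N \<Longrightarrow> f b \<in> F \<and> f b \<bullet> b \<noteq> 0" by metis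
      have nonneg: "f b \<bullet> b' \<ge> 0" if "b \<in> N" "b' \<in> N" for b b'
        using f[OF that(1)] that(2) a(2) by (auto simp: C)
      have "(\<Sum>b\<in>N. f b) \<bullet> b' > 0" if b': "b' \<in> N" for b'
        unfolding inner_sum_left using f[OF b'] nonneg b'
        by (intro sum_pos2[OF fin b']) (auto simp: order_less_le)
      then obtain e where e: "e > 0" "\<forall>b\<in>N. ((\<Sum>b\<in>N. f b) + e *\<^sub>R (- a)) \<bullet> b > 0"
        using strict_positivity_open[OF fin] by blast
      then have "(\<Sum>b\<in>N. f b) + e *\<^sub>R (- a) \<in> C" by (auto simp: C intro: less_imp_le)
      then have "((\<Sum>b\<in>N. f b) + e *\<^sub>R (- a)) \<bullet> a \<ge> 0" using a(3) by (auto simp: halfspace_def)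
      moreover have "(\<Sum>b\<in>N. f b) \<bullet> a = 0"
        using f a(2) by (auto simp: inner_sum_left hyperplane_def intro!: sum.neutral)
      moreover have "e * (a \<bullet> a) > 0" using e(1) a(1) by simp
      ultimately show False by (simp add: inner_diff_left)
    qed
    then obtain b where b: "b \<in> N" and Fb: "F \<subseteq> hyperplane b" by auto
    have b0: "b \<noteq> 0" using w[OF b] by auto
    have "0 \<in> F" using C0 a(2) by (simp add: hyperplane_def)
    then have "dim F = CARD('v) - 1" using dimF dimC by (simp add: aff_dim_zero_dim)
    then have span: "span F = hyperplane d" if "d \<noteq> 0" "F \<subseteq> hyperplane d" for d
      using dim_eq_span[OF that(2)] dim_hyperplane_origin[OF that(1)]
        span_eq_iff[of "hyperplane d"] subspace_hyperplane_origin by auto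
    have "hyperplane a = hyperplane b" using span[OF a(1)] span[OF b0 Fb] a(2) by auto
    then show "F \<in> {hyperplane b \<inter> C | b. b \<in> N}" using b a(2) by auto
  qed
qed

section \<open>Arcs of the cycle\<close>

text \<open>
  The parameters are the edges \<open>i\<close> and \<open>j\<close> that enter and leave the arc, not its end points, because the
  inequality of the arc compares the shares of these two edges.
\<close>

definition cyc_arc :: "nat \<Rightarrow> nat \<Rightarrow> nat \<Rightarrow> nat set" where
  "cyc_arc n i j = (if i < j then {i + 1..j} else {1..j} \<union> {i + 1..n})"

lemma sum_arc:
  fixes f :: "nat \<Rightarrow> real"
  assumes "i \<in> {1..n}" "j \<in> {1..n}"
  shows "sum f (cyc_arc n i j) = (\<Sum>p=1..j. f p) - (\<Sum>p=1..i. f p) + (if i < j then 0 else \<Sum>p=1..n. f p)"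
proof -
  have split: "(\<Sum>p=1..k. f p) = (\<Sum>p=1..m. f p) + sum f {m + 1..k}" if "m \<le> k" for m k
  proof -
    have "{1..k} = {1..m} \<union> {m + 1..k}" using that by auto
    then show ?thesis by (simp add: sum.union_disjoint)
  qed
  show ?thesis
  proof (cases "i < j")
    case True
    then show ?thesis using split[of i j] by (simp add: cyc_arc_def)
  next
    case False
    then have "sum f (cyc_arc n i j) = (\<Sum>p=1..j. f p) + sum f {i + 1..n}"
      by (auto simp: cyc_arc_def intro!: sum.union_disjoint)
    then show ?thesis using split[of i n] assms False by simp
  qed
qed

lemma card_arc:
  assumes "i \<in> {1..n}" "j \<in> {1..n}"
  shows "real (card (cyc_arc n i j)) = real j - real i + (if i < j then 0 else real n)"
  using sum_arc[OF assms, of "\<lambda>_. 1"] by simp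

lemma arc_subset: "i \<in> {1..n} \<Longrightarrow> j \<in> {1..n} \<Longrightarrow> cyc_arc n i j \<subseteq> {1..n}"
  by (auto simp: cyc_arc_def)

lemma cyc_sigma_funpow_eq:
  assumes "s \<in> {1..n}" "k \<le> n - 1"
  shows "(cyc_sigma n ^^ k) s = (if s + k \<le> n then s + k else s + k - n)"
proof -
  let ?t = "(cyc_sigma n ^^ k) s" and ?u = "if s + k \<le> n then s + k else s + k - n"
  have t: "?t \<in> {1..n}" "?t mod n = (k + s) mod n" using cyc_sigma_funpow[OF assms(1)] by auto
  have u: "?u \<in> {1..n}" using assms by auto
  have "?u mod n = (k + s) mod n" by (auto simp: add.commute le_mod_geq)
  then have "?t mod n = ?u mod n" using t by simp
  with t(1) u show ?thesis
    by (cases "?t = n"; cases "?u = n") auto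
qed

text \<open>The shift by \<open>0\<close> gives an arc that starts at position \<open>1\<close>, which is entered by edge \<open>n\<close>.\<close>

lemma cyc_sigma_image_arc:
  assumes "k \<le> n - 1" "1 \<le> i" "i \<le> n - 1"
  shows "(cyc_sigma n ^^ k) ` {1..i} =
    cyc_arc n (if k = 0 then n else k) (if k + i \<le> n then k + i else k + i - n)"
proof -
  have "(cyc_sigma n ^^ k) ` {1..i} = (\<lambda>s. if s + k \<le> n then s + k else s + k - n) ` {1..i}"
    using assms by (intro image_cong refl cyc_sigma_funpow_eq) auto
  also have "\<dots> = (if k + i \<le> n then {k + 1..k + i} else {k + 1..n} \<union> {1..k + i - n})"
  proof (intro equalityI subsetI)
    fix p assume p: "p \<in> (if k + i \<le> n then {k + 1..k + i} else {k + 1..n} \<union> {1..k + i - n})"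
    show "p \<in> (\<lambda>s. if s + k \<le> n then s + k else s + k - n) ` {1..i}"
    proof (cases "p > k")
      case True
      then show ?thesis using p assms by (intro image_eqI[of _ _ "p - k"]) (auto split: if_splits)
    next
      case False
      then show ?thesis using p assms by (intro image_eqI[of _ _ "p + n - k"]) (auto split: if_splits)
    qed
  qed (use assms in \<open>auto split: if_splits\<close>)
  also have "\<dots> = cyc_arc n (if k = 0 then n else k) (if k + i \<le> n then k + i else k + i - n)"
    using assms by (auto simp: cyc_arc_def)
  finally show ?thesis .
qed

lemma N_set_eq_arcs:
  assumes "2 \<le> n"
  shows "N_set n x = {nu n x (cyc_arc n i j) | i j. i \<in> {1..n} \<and> j \<in> {1..n} \<and> i \<noteq> j}"
proof -
  \<comment> \<open>The separately listed singletons are the shifts of \<open>{1..1}\<close>.\<close>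
  have single: "{k + 1} = (cyc_sigma n ^^ k) ` {1..1}" if "k \<le> n - 1" for k
    using cyc_sigma_funpow_eq[of 1 n k] that assms by auto
  have N: "N_set n x = {nu n x ((cyc_sigma n ^^ k) ` {1..i}) | k i. k \<le> n - 1 \<and> 1 \<le> i \<and> i \<le> n - 1}"
    (is "_ = ?R")
  proof (intro equalityI subsetI)
    fix a assume "a \<in> N_set n x"
    then consider k where "k \<le> n - 1" "a = nu n x {k + 1}"
      | k i where "a = nu n x ((cyc_sigma n ^^ k) ` {1..i})" "k \<le> n - 1" "2 \<le> i" "i \<le> n - 1"
      unfolding N_set_def by auto
    then show "a \<in> ?R"
    proof cases
      case 1
      then show ?thesis using single[of k] assms
        by (intro CollectI exI[of _ k] exI[of _ 1]) (auto simp del: One_nat_def)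
    next
      case 2
      then show ?thesis by (intro CollectI exI[of _ k] exI[of _ i]) auto
    qed
  next
    fix a assume "a \<in> ?R"
    then obtain k i where ki: "a = nu n x ((cyc_sigma n ^^ k) ` {1..i})" "k \<le> n - 1" "1 \<le> i" "i \<le> n - 1"
      by auto
    show "a \<in> N_set n x"
    proof (cases "i = 1")
      case True
      then have "a = nu n x {k + 1}" using ki single[of k] by simp
      then show ?thesis using ki(2) unfolding N_set_def by blast
    next
      case False
      then have "2 \<le> i" using ki(3) by simp
      then show ?thesis using ki unfolding N_set_def by blast
    qed
  qed
  show ?thesis unfolding N
  proof (intro equalityI subsetI)
    fix a assume "a \<in> ?R"
    then obtain k i where ki: "a = nu n x ((cyc_sigma n ^^ k) ` {1..i})" "k \<le> n - 1" "1 \<le> i" "i \<le> n - 1"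
      by auto
    then show "a \<in> {nu n x (cyc_arc n i j) | i j. i \<in> {1..n} \<and> j \<in> {1..n} \<and> i \<noteq> j}"
      unfolding ki(1) cyc_sigma_image_arc[OF ki(2-4)]
      by (intro CollectI exI[of _ "if k = 0 then n else k"]
        exI[of _ "if k + i \<le> n then k + i else k + i - n"]) auto
  next
    fix a assume "a \<in> {nu n x (cyc_arc n i j) | i j. i \<in> {1..n} \<and> j \<in> {1..n} \<and> i \<noteq> j}"
    then obtain i j where ij: "a = nu n x (cyc_arc n i j)" "i \<in> {1..n}" "j \<in> {1..n}" "i \<noteq> j" by auto
    let ?k = "if i = n then 0 else i" and ?m = "if i < j then j - i else if i = n then j else n + j - i"
    have km: "?k \<le> n - 1" "1 \<le> ?m" "?m \<le> n - 1" using ij by auto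
    have "(cyc_sigma n ^^ ?k) ` {1..?m} = cyc_arc n i j"
      unfolding cyc_sigma_image_arc[OF km] using ij by (auto intro!: arg_cong2[of _ _ _ _ "cyc_arc n"])
    then show "a \<in> ?R" using km ij(1) by (intro CollectI exI[of _ ?k] exI[of _ ?m]) auto
  qed
qed

section \<open>Splitting the mass of the edges\<close>

definition edge_vec :: "nat \<Rightarrow> (nat \<Rightarrow> 'v) \<Rightarrow> real \<Rightarrow> (nat \<Rightarrow> real) \<Rightarrow> real ^ 'v::finite" where
  "edge_vec n x c t = (\<Sum>j=1..n. t j *\<^sub>R axis (x j) 1 + (c - t j) *\<^sub>R axis (x (if j = n then 1 else j + 1)) 1)"

context
  fixes n :: nat and x :: "nat \<Rightarrow> 'v::finite"
  assumes n: "2 \<le> n" and x: "bij_betw x {1..n} UNIV"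
begin

lemma x_eq_iff: "p \<in> {1..n} \<Longrightarrow> q \<in> {1..n} \<Longrightarrow> x p = x q \<longleftrightarrow> p = q"
  using bij_betw_imp_inj_on[OF x] by (rule inj_on_eq_iff)

lemma vec_eqI_positions:
  assumes "\<And>p. p \<in> {1..n} \<Longrightarrow> y $ x p = z $ x p"
  shows "y = z"
proof -
  have "y $ v = z $ v" for v
  proof -
    have "v \<in> x ` {1..n}" using bij_betw_imp_surj_on[OF x] by simp
    then obtain p where "p \<in> {1..n}" "v = x p" by blast
    then show ?thesis using assms by simp
  qed
  then show ?thesis by (simp add: vec_eq_iff)
qed

lemma sum_positions: "(\<Sum>v\<in>UNIV. f v) = (\<Sum>p=1..n. f (x p))"
  by (rule sum.reindex_bij_betw[OF x, symmetric])

lemma edge_vec_nth: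
  assumes p: "p \<in> {1..n}"
  shows "edge_vec n x c t $ x p = t p + (c - t (if p = 1 then n else p - 1))"
proof -
  let ?q = "if p = 1 then n else p - 1" and ?s = "\<lambda>j. if j = n then 1 else j + 1"
  have 1: "(\<Sum>j=1..n. t j * (if x p = x j then 1 else 0)) = (\<Sum>j=1..n. if j = p then t j else 0)"
    using p x_eq_iff by (intro sum.cong) auto
  have 2: "(\<Sum>j=1..n. (c - t j) * (if x p = x (?s j) then 1 else 0)) = (\<Sum>j=1..n. if j = ?q then c - t j else 0)"
  proof (rule sum.cong)
    fix j assume j: "j \<in> {1..n}"
    have "x p = x (?s j) \<longleftrightarrow> p = ?s j" using p j n by (intro x_eq_iff) auto
    also have "\<dots> \<longleftrightarrow> j = ?q" using p j n by auto
    finally show "(c - t j) * (if x p = x (?s j) then 1 else 0) = (if j = ?q then c - t j else 0)"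
      by simp
  qed simp
  have q: "?q \<in> {1..n}" using p n by auto
  have "edge_vec n x c t $ x p = (\<Sum>j=1..n. t j * (if x p = x j then 1 else 0)) +
      (\<Sum>j=1..n. (c - t j) * (if x p = x (?s j) then 1 else 0))"
    unfolding edge_vec_def by (simp add: axis_def sum.distrib)
  then show ?thesis unfolding 1 2 using p q by (simp only: sum.delta finite_atLeastAtMost if_True)
qed

text \<open>The sums telescope: all edges but \<open>k\<close> and \<open>n\<close> have both ends or neither in \<open>{1..k}\<close>.\<close>

lemma sum_edge_vec:
  assumes "1 \<le> k" "k \<le> n"
  shows "(\<Sum>p=1..k. edge_vec n x c t $ x p) = real k * c + t k - t n"
  using assms
proof (induction k rule: dec_induct)
  case base
  then show ?case using n edge_vec_nth[of 1 c t] by simp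
next
  case (step k)
  then show ?case using edge_vec_nth[of "Suc k" c t] by (simp add: algebra_simps)
qed

lemma inner_nu:
  assumes S: "S \<subseteq> {1..n}"
  shows "y \<bullet> nu n x S = (real (card S) + 1) * (\<Sum>p=1..n. y $ x p) - real n * (\<Sum>p\<in>S. y $ x p)"
proof -
  have "y \<bullet> nu n x S = (\<Sum>p=1..n. y $ x p * (nu n x S $ x p))"
    by (simp add: inner_vec_def sum_positions)
  also have "\<dots> = (\<Sum>p=1..n. (real (card S) + 1) * y $ x p - real n * (if p \<in> S then y $ x p else 0))"
  proof (rule sum.cong)
    fix p assume "p \<in> {1..n}"
    then have "x p \<in> x ` S \<longleftrightarrow> p \<in> S" using S x_eq_iff by auto
    then show "y $ x p * (nu n x S $ x p) =
        (real (card S) + 1) * y $ x p - real n * (if p \<in> S then y $ x p else 0)"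
      by (simp add: nu_def algebra_simps)
  qed simp
  also have "\<dots> = (real (card S) + 1) * (\<Sum>p=1..n. y $ x p) - real n * (\<Sum>p=1..n. if p \<in> S then y $ x p else 0)"
    by (simp add: sum_subtractf sum_distrib_left)
  also have "(\<Sum>p=1..n. if p \<in> S then y $ x p else 0) = (\<Sum>p\<in>S. y $ x p)"
    using S by (simp add: sum.If_cases Collect_mem_eq Int_absorb1)
  finally show ?thesis .
qed

text \<open>
  For an arc with \<open>j < i\<close>, which runs past \<open>n\<close>, the formulas for its size and its mass have the extra
  terms \<open>n\<close> and the total mass.  These cancel in the inner product, so all arcs obey one formula.
\<close>

lemma edge_vec_inner_nu_arc:
  assumes "i \<in> {1..n}" "j \<in> {1..n}"
  shows "edge_vec n x c t \<bullet> nu n x (cyc_arc n i j) = real n * (c - t j + t i)"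
proof -
  have "1 \<le> i" "i \<le> n" "1 \<le> j" "j \<le> n" "1 \<le> n" using assms n by auto
  then show ?thesis unfolding inner_nu[OF arc_subset[OF assms]] card_arc[OF assms] sum_arc[OF assms]
    by (simp add: sum_edge_vec algebra_simps del: One_nat_def)
qed

text \<open>
  The partial sums of \<open>y p - c\<close>, with \<open>c\<close> the mean of \<open>y\<close>, return to \<open>0\<close> at \<open>n\<close>, so they solve the
  equations \<open>y p = c + t p - t (p - 1)\<close> around the cycle.
\<close>

lemma edge_vec_surj: "\<exists>c t. y = edge_vec n x c t"
proof -
  let ?c = "(\<Sum>p=1..n. y $ x p) / real n"
  let ?t = "\<lambda>k. (\<Sum>p=1..k. y $ x p - ?c)"
  have tn: "?t n = 0" using n by (simp add: sum_subtractf)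
  have "y = edge_vec n x ?c ?t"
  proof (rule vec_eqI_positions)
    fix p assume p: "p \<in> {1..n}"
    have "?t p = y $ x p - ?c + ?t (if p = 1 then n else p - 1)"
    proof (cases "p = 1")
      case True
      then show ?thesis using tn by simp
    next
      case False
      then obtain m where "p = Suc m" "m \<ge> 1" using p by (cases p) auto
      then show ?thesis by simp
    qed
    then show "y $ x p = edge_vec n x ?c ?t $ x p" using edge_vec_nth[OF p, of ?c ?t] by linarith
  qed
  then show ?thesis by (intro exI)
qed

lemma edge_vec_shift: "edge_vec n x c (\<lambda>j. t j - m) = edge_vec n x c t"
proof (rule vec_eqI_positions)
  fix p assume p: "p \<in> {1..n}"
  show "edge_vec n x c (\<lambda>j. t j - m) $ x p = edge_vec n x c t $ x p"
    unfolding edge_vec_nth[OF p] by simp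
qed

lemma dual_cone_imp_edge_vec:
  assumes y: "\<And>i j. i \<in> {1..n} \<Longrightarrow> j \<in> {1..n} \<Longrightarrow> i \<noteq> j \<Longrightarrow> y \<bullet> nu n x (cyc_arc n i j) \<ge> 0"
  shows "\<exists>c t. y = edge_vec n x c t \<and> (\<forall>j\<in>{1..n}. 0 \<le> t j \<and> t j \<le> c)"
proof -
  obtain c t where yct: "y = edge_vec n x c t" using edge_vec_surj[of y] by blast
  have d: "t j - t i \<le> c" if "i \<in> {1..n}" "j \<in> {1..n}" "i \<noteq> j" for i j
  proof -
    have "real n * (c - t j + t i) \<ge> 0" using y[OF that] edge_vec_inner_nu_arc[OF that(1,2)] yct by simp
    then show ?thesis using n by (simp add: zero_le_mult_iff)
  qed
  \<comment> \<open>The two inequalities for a pair of edges add up to \<open>0 \<le> 2 * c\<close>.\<close>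
  have c: "c \<ge> 0" using d[of 1 2] d[of 2 1] n by simp
  define m where "m = Min (t ` {1..n})"
  have "m \<in> t ` {1..n}" unfolding m_def using n by (intro Min_in) auto
  then obtain i where i: "i \<in> {1..n}" "m = t i" by auto
  have "0 \<le> t j - m \<and> t j - m \<le> c" if "j \<in> {1..n}" for j
  proof -
    have "m \<le> t j" unfolding m_def using that by (intro Min_le) auto
    then show ?thesis using that i c d[of i j] by (cases "i = j") auto
  qed
  then show ?thesis
    using edge_vec_shift[of c t m] yct by (intro exI[of _ c] exI[of _ "\<lambda>j. t j - m"]) auto
qed

section \<open>The cone spanned by the exponent vectors\<close>

lemma real_vec_log_monomial:
  fixes f :: "nat \<Rightarrow> 'v"
  assumes "finite J"
  shows "real_vec (log_monomial {# f j. j \<in># mset_set J #}) = (\<Sum>j\<in>J. axis (f j) 1)"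
  using assms
  by (induction J rule: finite_induct) (auto simp: real_vec_def log_monomial_def vec_eq_iff axis_def)

lemma real_vec_A_set:
  "real_vec ` A_set n x = {edge_vec n x 1 t | t. \<forall>j\<in>{1..n}. t j \<in> {0, 1}}"
proof -
  let ?s = "\<lambda>j. if j = n then 1 else j + 1"
  have log: "real_vec (log_monomial {# x (i j). j \<in># mset_set {1..n} #}) = (\<Sum>j=1..n. axis (x (i j)) 1)" for i
    by (rule real_vec_log_monomial) simp
  show ?thesis
  proof (intro equalityI subsetI)
    fix u assume "u \<in> real_vec ` A_set n x"
    then obtain i where u: "u = real_vec (log_monomial {# x (i j). j \<in># mset_set {1..n} #})"
      and i: "\<forall>j\<in>{1..<n}. i j \<in> {j, j + 1}" "i n \<in> {1, n}" by (auto simp: A_set_def)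
    let ?t = "\<lambda>j. if i j = j then 1 else 0 :: real"
    have "u = edge_vec n x 1 ?t" unfolding u log edge_vec_def
    proof (rule sum.cong)
      fix j assume j: "j \<in> {1..n}"
      have "i j \<in> {j, ?s j}" using i j by (cases "j = n") auto
      then show "axis (x (i j)) 1 = ?t j *\<^sub>R axis (x j) 1 + (1 - ?t j) *\<^sub>R axis (x (?s j)) 1"
        by auto
    qed simp
    then show "u \<in> {edge_vec n x 1 t | t. \<forall>j\<in>{1..n}. t j \<in> {0, 1}}"
      by (intro CollectI exI[of _ ?t]) auto
  next
    fix u assume "u \<in> {edge_vec n x 1 t | t. \<forall>j\<in>{1..n}. t j \<in> {0, 1}}"
    then obtain t where u: "u = edge_vec n x 1 t" and t: "\<And>j. j \<in> {1..n} \<Longrightarrow> t j \<in> {0, 1}" by auto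
    let ?i = "\<lambda>j. if t j = 1 then j else ?s j"
    have "u = real_vec (log_monomial {# x (?i j). j \<in># mset_set {1..n} #})"
      unfolding u log edge_vec_def
    proof (rule sum.cong)
      fix j assume "j \<in> {1..n}"
      from t[OF this] show "t j *\<^sub>R axis (x j) 1 + (1 - t j) *\<^sub>R axis (x (?s j)) 1 = axis (x (?i j)) (1::real)"
        by auto
    qed simp
    moreover have "log_monomial {# x (?i j). j \<in># mset_set {1..n} #} \<in> A_set n x"
      unfolding A_set_def by (intro CollectI exI[of _ ?i]) auto
    ultimately show "u \<in> real_vec ` A_set n x" by blast
  qed
qed

lemma edge_vec_scale: "s *\<^sub>R edge_vec n x c t = edge_vec n x (s * c) (\<lambda>j. s * t j)"
proof (rule vec_eqI_positions)
  fix p assume p: "p \<in> {1..n}"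
  show "(s *\<^sub>R edge_vec n x c t) $ x p = edge_vec n x (s * c) (\<lambda>j. s * t j) $ x p"
    by (simp add: edge_vec_nth[OF p] algebra_simps)
qed

text \<open>
  Induction on the number \<open>k\<close> of edges whose mass may be split.  The vector depends affinely on the share
  \<open>t (Suc k)\<close>, so it lies between the vectors for the two extreme values of this share.
\<close>

lemma edge_vec_in_cone_upto:
  assumes "c > 0" "k \<le> n" "\<And>j. j \<in> {1..k} \<Longrightarrow> 0 \<le> t j \<and> t j \<le> c"
    "\<And>j. j \<in> {k + 1..n} \<Longrightarrow> t j \<in> {0, c}"
  shows "edge_vec n x c t \<in> R_cone (A_set n x)"
  using assms(2-4)
proof (induction k arbitrary: t)
  case 0
  let ?t = "\<lambda>j. t j / c"
  have "edge_vec n x 1 ?t \<in> real_vec ` A_set n x"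
    unfolding real_vec_A_set using 0 assms(1) by force
  then have "c *\<^sub>R edge_vec n x 1 ?t \<in> R_cone (A_set n x)"
    unfolding R_cone_def using assms(1) nonneg_cone_superset[of "real_vec ` A_set n x"]
    by (intro nonneg_cone_scaleR) (auto intro: less_imp_le)
  then show ?case using assms(1) by (simp add: edge_vec_scale)
next
  case (Suc k)
  let ?r = "t (Suc k)"
  have r: "0 \<le> ?r" "?r \<le> c" using Suc.prems(2)[of "Suc k"] by auto
  have ends: "edge_vec n x c (t(Suc k := d)) \<in> R_cone (A_set n x)" if "d \<in> {0, c}" for d
  proof (rule Suc.IH)
    show "(t(Suc k := d)) j \<in> {0, c}" if "j \<in> {k + 1..n}" for j
      using that Suc.prems(3)[of j] \<open>d \<in> {0, c}\<close> by (cases "j = Suc k") auto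
  qed (use Suc.prems in auto)
  have "edge_vec n x c t = (?r / c) *\<^sub>R edge_vec n x c (t(Suc k := c)) +
      ((c - ?r) / c) *\<^sub>R edge_vec n x c (t(Suc k := 0))" (is "_ = ?rhs")
  proof (rule vec_eqI_positions)
    fix p assume p: "p \<in> {1..n}"
    show "edge_vec n x c t $ x p = ?rhs $ x p"
      using assms(1) by (simp add: edge_vec_nth[OF p] field_simps)
  qed
  also have "\<dots> \<in> R_cone (A_set n x)"
    using ends[of 0] ends[of c] r assms(1) unfolding R_cone_def
    by (intro nonneg_cone_add nonneg_cone_scaleR) auto
  finally show ?case .
qed

lemma edge_vec_in_cone:
  assumes "\<And>j. j \<in> {1..n} \<Longrightarrow> 0 \<le> t j \<and> t j \<le> c"
  shows "edge_vec n x c t \<in> R_cone (A_set n x)"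
proof (cases "c > 0")
  case True
  then show ?thesis using assms by (intro edge_vec_in_cone_upto[of c n]) auto
next
  case False
  have "0 \<le> c" using assms[of 1] n by auto
  with False have c: "c = 0" by simp
  have t: "t j = 0" if "j \<in> {1..n}" for j using assms[OF that] c by simp
  have "edge_vec n x c t = 0"
  proof (rule vec_eqI_positions)
    fix p assume p: "p \<in> {1..n}"
    then have "(if p = 1 then n else p - 1) \<in> {1..n}" by auto
    then show "edge_vec n x c t $ x p = 0 $ x p" using t[OF p] t c by (simp add: edge_vec_nth[OF p])
  qed
  then show ?thesis by (simp add: R_cone_def nonneg_cone_zero)
qed

lemma R_cone_A_set_subset_halfspace:
  assumes "i \<in> {1..n}" "j \<in> {1..n}"
  shows "R_cone (A_set n x) \<subseteq> halfspace (nu n x (cyc_arc n i j))"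
proof
  fix y assume "y \<in> R_cone (A_set n x)"
  then obtain T a where T: "y = (\<Sum>\<gamma>\<in>T. a \<gamma> *\<^sub>R \<gamma>)" "T \<subseteq> real_vec ` A_set n x" "\<forall>\<gamma>\<in>T. 0 \<le> a \<gamma>"
    unfolding R_cone_def nonneg_cone_def by blast
  have "\<gamma> \<bullet> nu n x (cyc_arc n i j) \<ge> 0" if \<gamma>: "\<gamma> \<in> T" for \<gamma>
  proof -
    obtain t where t: "\<gamma> = edge_vec n x 1 t" "\<And>j. j \<in> {1..n} \<Longrightarrow> t j \<in> {0, 1}"
      using subsetD[OF T(2) \<gamma>] unfolding real_vec_A_set by auto
    have "1 - t j + t i \<ge> 0" using t(2)[OF assms(1)] t(2)[OF assms(2)] by auto
    then show ?thesis using assms t(1) by (simp add: edge_vec_inner_nu_arc)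
  qed
  then show "y \<in> halfspace (nu n x (cyc_arc n i j))"
    using T(1,3) by (auto simp: halfspace_def inner_sum_left intro!: sum_nonneg)
qed

lemma R_cone_A_set_eq: "R_cone (A_set n x) = (\<Inter>a\<in>N_set n x. halfspace a)"
proof (intro equalityI subsetI)
  fix y assume "y \<in> R_cone (A_set n x)"
  then show "y \<in> (\<Inter>a\<in>N_set n x. halfspace a)"
    unfolding N_set_eq_arcs[OF n] using R_cone_A_set_subset_halfspace by blast
next
  fix y assume y: "y \<in> (\<Inter>a\<in>N_set n x. halfspace a)"
  have "y \<bullet> nu n x (cyc_arc n i j) \<ge> 0" if "i \<in> {1..n}" "j \<in> {1..n}" "i \<noteq> j" for i j
    using y that unfolding N_set_eq_arcs[OF n] halfspace_def by blast
  from dual_cone_imp_edge_vec[OF this] show "y \<in> R_cone (A_set n x)"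
    using edge_vec_in_cone by blast
qed

lemma facets_R_cone_A_set:
  "{F. cone_facet F (R_cone (A_set n x))} = {hyperplane a \<inter> R_cone (A_set n x) | a. a \<in> N_set n x}"
  unfolding R_cone_A_set_eq
proof (rule facets_of_irredundant_cone)
  have "N_set n x \<subseteq> (\<lambda>(i, j). nu n x (cyc_arc n i j)) ` ({1..n} \<times> {1..n})"
    unfolding N_set_eq_arcs[OF n] by auto
  then show "finite (N_set n x)" by (rule finite_subset) auto
next
  fix b assume "b \<in> N_set n x"
  then obtain i j where ij: "b = nu n x (cyc_arc n i j)" "i \<in> {1..n}" "j \<in> {1..n}" "i \<noteq> j"
    unfolding N_set_eq_arcs[OF n] by auto
  \<comment> \<open>Equal shares on all edges.\<close>
  show "edge_vec n x 2 (\<lambda>_. 1) \<bullet> b > 0" using ij n by (simp add: edge_vec_inner_nu_arc)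
  \<comment> \<open>The shares have their largest possible difference \<open>2\<close> for the pair \<open>(i, j)\<close> and for no other.\<close>
  let ?t = "\<lambda>k. if k = j then 2 else if k = i then 0 else 1 :: real"
  show "\<exists>z. z \<bullet> b = 0 \<and> (\<forall>b'\<in>N_set n x - {b}. z \<bullet> b' > 0)"
  proof (intro exI[of _ "edge_vec n x 2 ?t"] conjI ballI)
    show "edge_vec n x 2 ?t \<bullet> b = 0" using ij by (simp add: edge_vec_inner_nu_arc)
  next
    fix b' assume b': "b' \<in> N_set n x - {b}"
    then obtain l m where lm: "b' = nu n x (cyc_arc n l m)" "l \<in> {1..n}" "m \<in> {1..n}" "l \<noteq> m"
      unfolding N_set_eq_arcs[OF n] by auto
    have "(l, m) \<noteq> (i, j)" using b' lm(1) ij(1) by auto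
    then show "edge_vec n x 2 ?t \<bullet> b' > 0"
      using lm n ij(4) by (auto simp: edge_vec_inner_nu_arc)
  qed
qed

end

theorem theorem4p1:
  fixes n :: nat and x :: "nat \<Rightarrow> 'v::finite"
  assumes "2 \<le> n" and "CARD('v) = n" and "bij_betw x {1..n} UNIV"
  shows "R_cone (gen_semigroup (A_set n x)) = (\<Inter>a\<in>N_set n x. halfspace a) \<and>
    {F. cone_facet F (R_cone (gen_semigroup (A_set n x)))} =
      {hyperplane a \<inter> R_cone (gen_semigroup (A_set n x)) | a. a \<in> N_set n x}"
  unfolding R_cone_gen_semigroup
  using R_cone_A_set_eq[OF assms(1,3)] facets_R_cone_A_set[OF assms(1,3)] by blast

end
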